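(* Let $K$ be a number field with algebraic closure $\overline{K}$, let $c\in K$, $c\neq 0$, and let $\mathcal{E}$ be the elliptic curve over $K$ with Weierstrass equation $y^2=x^3+c$. Let $\zeta_3,\zeta_5\in\overline{K}$ be primitive $3$-rd and $5$-th roots of unity respectively, and put $$\delta_1:=-\frac{(-132\zeta_3+24)\zeta_5^3+(36\zeta_3+108)\zeta_5^2+(-96\zeta_3-48)\zeta_5-48\zeta_3+116}{5}.$$ Then $$K_5=K\left(\sqrt[3]{\delta_1 c},\ \zeta_3,\ \sqrt{(\delta_1+1)c}\right).$$
   Context: $\mathcal{E}[5]$ denotes the $5$-torsion subgroup of $\mathcal{E}(\overline{K})$, and $K_5:=K(\mathcal{E}[5])$ is the field obtained by adjoining to $K$ the coordinates of all the points of $\mathcal{E}[5]$. The symbols $\sqrt[3]{\delta_1 c}$ and $\sqrt{(\delta_1+1)c}$ denote a fixed cube root and a fixed square root in $\overline{K}$. *)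

theory Defs
  imports "HOL-Algebra.Algebraic_Closure_Type" "HOL-Algebra.Generated_Fields"
begin

text \<open>The ambient field is a type \<open>'a\<close> of characteristic 0, viewed as a ring record with carrier
  \<open>UNIV\<close>; its subfields, in particular number fields, are sets.\<close>

abbreviation ambient_ring :: "'a::field_char_0 ring"
  where "ambient_ring \<equiv> ring_of_type_algebra"

definition number_field :: "'a::field_char_0 set \<Rightarrow> bool"
  where "number_field K \<longleftrightarrow>
    subfield K ambient_ring \<and> ring.finite_dimension ambient_ring \<rat> K"

definition adjoin :: "'a::field_char_0 set \<Rightarrow> 'a set \<Rightarrow> 'a set"
  where "adjoin K S = generate_field ambient_ring (K \<union> S)"

definition primitive_root_of_unity :: "nat \<Rightarrow> 'a::field \<Rightarrow> bool"
  where "primitive_root_of_unity n z \<longleftrightarrow>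
    n > 0 \<and> z ^ n = 1 \<and> (\<forall>k. 0 < k \<and> k < n \<longrightarrow> z ^ k \<noteq> 1)"

datatype 'a point = Infinity | Affine 'a 'a

text \<open>Points with coordinates in the ambient field on \<open>y\<^sup>2 = x\<^sup>3 + a x + b\<close>.\<close>

definition curve_points :: "'a::field_char_0 \<Rightarrow> 'a \<Rightarrow> 'a point set"
  where "curve_points a b =
    insert Infinity {Affine x y | x y. y ^ 2 = x ^ 3 + a * x + b}"

text \<open>The chord-and-tangent group law. It is only meaningful for two points of the same curve
  \<open>y\<^sup>2 = x\<^sup>3 + a x + b\<close>; the coefficient \<open>b\<close> does not occur in the formulas. In the tangent case
  both points lie on the curve, so \<open>x1 = x2\<close> and \<open>y1 \<noteq> - y2\<close> force \<open>y1 = y2 \<noteq> 0\<close>.\<close>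

fun point_add :: "'a::field_char_0 \<Rightarrow> 'a point \<Rightarrow> 'a point \<Rightarrow> 'a point" where
  "point_add a Infinity Q = Q"
| "point_add a P Infinity = P"
| "point_add a (Affine x1 y1) (Affine x2 y2) =
    (if x1 = x2 \<and> y1 = - y2 then Infinity
     else let m = (if x1 = x2 then (3 * x1 ^ 2 + a) / (2 * y1) else (y2 - y1) / (x2 - x1));
              x3 = m ^ 2 - x1 - x2
          in Affine x3 (m * (x1 - x3) - y1))"

definition point_mult :: "'a::field_char_0 \<Rightarrow> nat \<Rightarrow> 'a point \<Rightarrow> 'a point"
  where "point_mult a n P = (point_add a P ^^ n) Infinity"

definition torsion_points :: "'a::field_char_0 \<Rightarrow> 'a \<Rightarrow> nat \<Rightarrow> 'a point set"
  where "torsion_points a b n = {P \<in> curve_points a b. point_mult a n P = Infinity}"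

fun coordinates :: "'a point \<Rightarrow> 'a set" where
  "coordinates Infinity = {}"
| "coordinates (Affine x y) = {x, y}"

definition division_field :: "'a::field_char_0 set \<Rightarrow> 'a \<Rightarrow> 'a \<Rightarrow> nat \<Rightarrow> 'a set"
  where "division_field K a b n = adjoin K (\<Union>P\<in>torsion_points a b n. coordinates P)"

definition delta1 :: "'a::field_char_0 \<Rightarrow> 'a \<Rightarrow> 'a"
  where "delta1 \<zeta>3 \<zeta>5 =
    - (((- 132 * \<zeta>3 + 24) * \<zeta>5 ^ 3 + (36 * \<zeta>3 + 108) * \<zeta>5 ^ 2
        + (- 96 * \<zeta>3 - 48) * \<zeta>5 - 48 * \<zeta>3 + 116) / 5)"

end

theory Submission
  imports Defs
begin

text \<open>
  Write an affine point as \<open>(x, y)\<close> with \<open>x\<^sup>3 = \<delta> c\<close>, \<open>y\<^sup>2 = (\<delta> + 1) c\<close>. The 5-division polynomial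
  becomes a quartic in \<open>\<delta>\<close>, of which \<open>\<delta>\<^sub>1\<close> is a root; so \<open>P = (r, s)\<close> and \<open>(\<zeta>\<^sub>3 r, s)\<close> are 5-torsion
  points, which gives one inclusion. Conversely, \<open>E[5]\<close> is generated by \<open>P\<close> over \<open>\<int>[\<zeta>\<^sub>3]\<close>, and up to the six
  automorphisms \<open>(x, y) \<mapsto> (\<zeta>\<^sub>3\<^sup>i x, \<plusminus>y)\<close> its nonzero points are \<open>P\<close>, \<open>2P\<close>, \<open>(1 - \<zeta>\<^sub>3)P\<close> and
  \<open>2(1 - \<zeta>\<^sub>3)P\<close>. In terms of \<open>\<delta>\<close> this says that the four roots of the quartic are obtained from \<open>\<delta>\<^sub>1\<close> by
  the rational maps induced by doubling and by \<open>1 - \<zeta>\<^sub>3\<close>.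
\<close>

section \<open>Subfields of the ambient ring\<close>

lemma ambient_field: "field (ambient_ring :: 'a::field_char_0 ring)"
  by (rule field_from_type_algebra)

lemma ambient_ring_simps:
  "carrier (ambient_ring :: 'a::field_char_0 ring) = UNIV"
  "\<zero>\<^bsub>(ambient_ring :: 'a ring)\<^esub> = 0"
  "\<one>\<^bsub>(ambient_ring :: 'a ring)\<^esub> = 1"
  "x \<oplus>\<^bsub>(ambient_ring :: 'a ring)\<^esub> y = x + y"
  "x \<otimes>\<^bsub>(ambient_ring :: 'a ring)\<^esub> y = x * y"
  by (simp_all add: ring_of_type_algebra_def)

lemma ambient_ring_a_inv: "\<ominus>\<^bsub>ambient_ring\<^esub> (x :: 'a::field_char_0) = - x"
proof -
  interpret field "ambient_ring :: 'a ring" by (rule ambient_field)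
  show ?thesis
    by (rule minus_equality) (simp_all add: ambient_ring_simps)
qed

lemma ambient_ring_m_inv:
  assumes "x \<noteq> (0 :: 'a::field_char_0)"
  shows "inv\<^bsub>ambient_ring\<^esub> x = inverse x"
proof -
  interpret field "ambient_ring :: 'a ring" by (rule ambient_field)
  show ?thesis
    by (rule comm_inv_char) (simp_all add: ambient_ring_simps assms)
qed

lemma adjoin_subfield: "subfield (adjoin K S) (ambient_ring :: 'a::field_char_0 ring)"
  unfolding adjoin_def
  by (rule field.generate_field_is_subfield[OF ambient_field]) (simp add: ambient_ring_simps)

lemma adjoin_incl: "x \<in> K \<union> S \<Longrightarrow> x \<in> adjoin K S"
  unfolding adjoin_def by (rule generate_field.incl)

lemma adjoin_minimal:
  assumes "subfield F (ambient_ring :: 'a::field_char_0 ring)" "K \<subseteq> F" "S \<subseteq> F"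
  shows "adjoin K S \<subseteq> F"
  unfolding adjoin_def
  by (rule field.generate_field_min_subfield1[OF ambient_field])
    (use assms in \<open>auto simp: ambient_ring_simps\<close>)

context
  fixes F :: "'a::field_char_0 set"
  assumes F: "subfield F ambient_ring"
begin

lemma subfield_add: "x \<in> F \<Longrightarrow> y \<in> F \<Longrightarrow> x + y \<in> F"
  using subringE(7)[OF subfieldE(1)[OF F]] by (simp add: ambient_ring_simps)

lemma subfield_mult: "x \<in> F \<Longrightarrow> y \<in> F \<Longrightarrow> x * y \<in> F"
  using subringE(6)[OF subfieldE(1)[OF F]] by (simp add: ambient_ring_simps)

lemma subfield_uminus: "x \<in> F \<Longrightarrow> - x \<in> F"
  using subringE(5)[OF subfieldE(1)[OF F]] by (simp add: ambient_ring_a_inv)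

lemma subfield_zero: "0 \<in> F"
  using subringE(2)[OF subfieldE(1)[OF F]] by (simp add: ambient_ring_simps)

lemma subfield_one: "1 \<in> F"
  using subringE(3)[OF subfieldE(1)[OF F]] by (simp add: ambient_ring_simps)

text \<open>At zero the convention \<open>inverse 0 = 0\<close> gives membership, so closure under
  inverses and division carries no side condition.\<close>

lemma subfield_inverse: "x \<in> F \<Longrightarrow> inverse x \<in> F"
  using ring.subfield_m_inv(1)[OF ring_from_type_algebra F, of x]
  by (cases "x = 0") (simp_all add: ambient_ring_simps ambient_ring_m_inv)

lemma subfield_diff: "x \<in> F \<Longrightarrow> y \<in> F \<Longrightarrow> x - y \<in> F"
  using subfield_add[of x "- y"] subfield_uminus by simp

lemma subfield_divide: "x \<in> F \<Longrightarrow> y \<in> F \<Longrightarrow> x / y \<in> F"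
  by (simp add: divide_inverse subfield_mult subfield_inverse)

lemma subfield_power: "x \<in> F \<Longrightarrow> x ^ n \<in> F"
  by (induction n) (simp_all add: subfield_mult subfield_one)

lemma subfield_of_nat: "of_nat n \<in> F"
  by (induction n) (simp_all add: subfield_add subfield_one subfield_zero)

lemma subfield_numeral: "numeral n \<in> F"
  using subfield_of_nat[of "numeral n"] by simp

lemmas subfield_closed = subfield_add subfield_mult subfield_uminus subfield_zero subfield_one
  subfield_inverse subfield_diff subfield_divide subfield_power subfield_numeral

end

section \<open>The quartic \<open>psi5\<close> and its four roots\<close>

text \<open>\<open>c\<^sup>4 psi5 \<delta>\<close> is the 5-division polynomial of \<open>y\<^sup>2 = x\<^sup>3 + c\<close> at \<open>x\<^sup>3 = \<delta> c\<close>.\<close>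

definition psi5 :: "'a::field_char_0 \<Rightarrow> 'a"
  where "psi5 \<delta> = 5 * \<delta> ^ 4 + 380 * \<delta> ^ 3 - 240 * \<delta> ^ 2 - 1600 * \<delta> - 256"

lemma psi5_delta1:
  assumes w: "w ^ 2 + w + 1 = (0 :: 'a::field_char_0)" and z: "z ^ 4 + z ^ 3 + z ^ 2 + z + 1 = 0"
  shows "psi5 (delta1 w z) = 0"
proof -
  \<comment> \<open>Since \<open>1 + 2 t\<close> is a square root of 5, the quartic splits over \<open>\<rat>(t)\<close> into two quadratics.\<close>
  define t where "t = z + z ^ 4"
  \<comment> \<open>The unqualified name of this method is taken over by HOL-Algebra.\<close>
  have t: "t ^ 2 + t - 1 = 0" unfolding t_def using z by Groebner_Basis.algebra
  define a where "a = delta1 w z"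
  have a: "5 * a = - ((- 132 * w + 24) * z ^ 3 + (36 * w + 108) * z ^ 2
        + (- 96 * w - 48) * z - 48 * w + 116)"
    unfolding a_def delta1_def
    by (simp only: mult_minus_right times_divide_eq_right nonzero_mult_div_cancel_left[OF zero_neq_numeral[symmetric]])
  \<comment> \<open>The product of this quadratic and its conjugate under
    \<open>t \<mapsto> - 1 - t\<close> is \<open>5 * psi5 a\<close>.\<close>
  have "5 * (5 * a ^ 2 + (100 - 180 * t) * a + 176 - 288 * t) = 0"
    unfolding t_def using a w z by Groebner_Basis.algebra
  then have "5 * a ^ 2 + (100 - 180 * t) * a + 176 - 288 * t = 0"
    by (simp only: mult_eq_0_iff) simp
  then have "5 * psi5 a = 0" unfolding psi5_def using t by Groebner_Basis.algebra
  then show ?thesis by (simp add: a_def)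
qed

text \<open>The quartic takes the values -256 at 0 and 729 at -1. These arguments belong to points
  with \<open>x = 0\<close> (order 3) and \<open>y = 0\<close> (order 2).\<close>

lemma psi5_nonzero:
  assumes "psi5 a = (0 :: 'a::field_char_0)"
  shows "a \<noteq> 0" "a \<noteq> - 1"
  using assms by (auto simp: psi5_def)

text \<open>The cubics come from inverting \<open>a + 1\<close> and \<open>a\<close> modulo the quartic; without denominators the
  comparison of the four roots is a polynomial identity.\<close>

lemma double_reduced:
  assumes a: "psi5 a = (0 :: 'a::field_char_0)" and b: "64 * (a + 1) ^ 3 * b = a * (a - 8) ^ 3"
  shows "144 * b = 1088 + 4176 * a - 1860 * a ^ 2 - 25 * a ^ 3"
proof -
  have "a + 1 \<noteq> 0" using psi5_nonzero[OF a] by (simp add: eq_neg_iff_add_eq_0)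
  moreover have "(a + 1) ^ 3 * (144 * b - (1088 + 4176 * a - 1860 * a ^ 2 - 25 * a ^ 3)) = 0"
    using a b unfolding psi5_def by Groebner_Basis.algebra
  ultimately show ?thesis by simp
qed

lemma isogeny_reduced:
  assumes a: "psi5 a = (0 :: 'a::field_char_0)" and c: "27 * a ^ 2 * c = - ((a + 4) ^ 3)"
  shows "216 * c = - 17216 - 3408 * a + 4170 * a ^ 2 + 55 * a ^ 3"
proof -
  have "a ^ 2 * (216 * c - (- 17216 - 3408 * a + 4170 * a ^ 2 + 55 * a ^ 3)) = 0"
    using a c unfolding psi5_def by Groebner_Basis.algebra
  then show ?thesis using psi5_nonzero[OF a] by simp
qed

text \<open>Multiplication by \<open>1 - \<zeta>\<^sub>3\<close> preserves 5-torsion. It follows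
  that the doubling formula can be reduced at \<open>c\<close> as well.\<close>

lemma psi5_isogeny:
  assumes a: "psi5 a = (0 :: 'a::field_char_0)" and c: "27 * a ^ 2 * c = - ((a + 4) ^ 3)"
  shows "psi5 c = 0"
proof -
  have "216 ^ 4 * psi5 c = 0"
    using a isogeny_reduced[OF a c] unfolding psi5_def by Groebner_Basis.algebra
  then show ?thesis by simp
qed

text \<open>If \<open>a\<close> belongs to \<open>P\<close>, then \<open>b\<close>,
  \<open>c\<close>, \<open>d\<close> belong to \<open>2P\<close>,
  \<open>(1 - \<zeta>\<^sub>3)P\<close>, \<open>2(1 - \<zeta>\<^sub>3)P\<close>. Modulo
  \<open>psi5 a\<close>, five times the product of the differences is \<open>psi5 T\<close>.\<close>

lemma psi5_roots:
  assumes a: "psi5 a = (0 :: 'a::field_char_0)" and T: "psi5 T = 0"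
    and b: "64 * (a + 1) ^ 3 * b = a * (a - 8) ^ 3"
    and c: "27 * a ^ 2 * c = - ((a + 4) ^ 3)"
    and d: "64 * (c + 1) ^ 3 * d = c * (c - 8) ^ 3"
  shows "T \<in> {a, b, c, d}"
proof -
  note b' = double_reduced[OF a b]
  note c' = isogeny_reduced[OF a c] and c5 = psi5_isogeny[OF a c]
  note d1 = double_reduced[OF c5 d]
  have "216 ^ 3 * (432 * d - (- 1664 - 6144 * a - 2760 * a ^ 2 - 35 * a ^ 3)) = 0"
    using a c' d1 unfolding psi5_def by Groebner_Basis.algebra
  then have d': "432 * d = - 1664 - 6144 * a - 2760 * a ^ 2 - 35 * a ^ 3"
    by (simp only: mult_eq_0_iff power_eq_0_iff) simp
  have "144 * 216 * 432 * ((T - a) * (T - b) * (T - c) * (T - d)) = 0"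
    using a T b' c' d' unfolding psi5_def by Groebner_Basis.algebra
  then show ?thesis by auto
qed

section \<open>Doubling and \<open>1 - w\<close> over a subfield\<close>

text \<open>The witnesses are the coordinates of \<open>2(r, s)\<close>.\<close>

lemma double_rational:
  assumes F: "subfield F ambient_ring" and mem: "r \<in> F" "s \<in> F" "\<delta> \<in> F"
    and r: "r ^ 3 = \<delta> * c" and s: "s ^ 2 = (\<delta> + 1) * c" and "\<delta> \<noteq> - 1"
  defines "\<delta>' \<equiv> \<delta> * (\<delta> - 8) ^ 3 / (64 * (\<delta> + 1) ^ 3)"
  shows "\<exists>r'\<in>F. \<exists>s'\<in>F. r' ^ 3 = \<delta>' * c \<and> s' ^ 2 = (\<delta>' + 1) * c"
proof (intro bexI conjI)
  have nz: "\<delta> + 1 \<noteq> 0" using \<open>\<delta> \<noteq> - 1\<close> by (simp add: eq_neg_iff_add_eq_0)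
  show "(r * (\<delta> - 8) / (4 * (\<delta> + 1))) ^ 3 = \<delta>' * c"
    using nz by (simp only: \<delta>'_def power_mult_distrib power_divide r) simp
  have "\<delta>' + 1 = (\<delta> + 1) * (\<delta> ^ 2 + 20 * \<delta> - 8) ^ 2 / (8 * (\<delta> + 1) ^ 2) ^ 2"
    unfolding \<delta>'_def using nz by (simp add: divide_simps) Groebner_Basis.algebra
  then show "(s * (\<delta> ^ 2 + 20 * \<delta> - 8) / (8 * (\<delta> + 1) ^ 2)) ^ 2 = (\<delta>' + 1) * c"
    by (simp add: power_mult_distrib power_divide s)
qed (intro mem subfield_closed[OF F])+

text \<open>The witnesses are the coordinates of \<open>(1 - w)(r, s) = (r, s) - (w r, s)\<close>.\<close>

lemma isogeny_rational:
  assumes F: "subfield F ambient_ring" and mem: "r \<in> F" "s \<in> F" "\<delta> \<in> F" "w \<in> F"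
    and r: "r ^ 3 = \<delta> * c" and s: "s ^ 2 = (\<delta> + 1) * c" and nz: "\<delta> \<noteq> 0"
    and w: "w ^ 2 + w + 1 = 0"
  defines "\<delta>' \<equiv> - ((\<delta> + 4) ^ 3) / (27 * \<delta> ^ 2)"
  shows "\<exists>r'\<in>F. \<exists>s'\<in>F. r' ^ 3 = \<delta>' * c \<and> s' ^ 2 = (\<delta>' + 1) * c"
proof (intro bexI conjI)
  have w3: "w ^ 3 = 1" using w by Groebner_Basis.algebra
  \<comment> \<open>This square root of -3 supplies the factor by which \<open>\<delta>' + 1\<close>
    differs from \<open>\<delta> + 1\<close> up to squares.\<close>
  have w2: "(2 * w + 1) ^ 2 = - 3" using w by Groebner_Basis.algebra
  show "(- ((\<delta> + 4) * r) / (3 * w * \<delta>)) ^ 3 = \<delta>' * c"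
    using nz by (simp add: \<delta>'_def power_mult_distrib power_divide r w3 divide_simps) Groebner_Basis.algebra
  have "\<delta>' + 1 = - ((\<delta> + 1) * (\<delta> - 8) ^ 2 / (27 * \<delta> ^ 2))"
    unfolding \<delta>'_def using nz by (simp add: divide_simps) Groebner_Basis.algebra
  then show "(s * (\<delta> - 8) / (3 * (2 * w + 1) * \<delta>)) ^ 2 = (\<delta>' + 1) * c"
    by (simp only: power_mult_distrib power_divide s w2) simp
qed (intro mem subfield_closed[OF F])+

text \<open>Points with the same \<open>\<delta>\<close> form one orbit under
  \<open>(x, y) \<mapsto> (w\<^sup>i x, \<plusminus>y)\<close>, so one point over \<open>F\<close>
  suffices for all of them.\<close>

lemma rational_if_cube_eq:
  assumes F: "subfield F ambient_ring" and mem: "r \<in> F" "s \<in> F" "w \<in> F"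
    and w: "w ^ 2 + w + 1 = (0::'a::field_char_0)"
    and x: "x ^ 3 = r ^ 3" and y: "y ^ 2 = s ^ 2"
  shows "x \<in> F \<and> y \<in> F"
proof
  have "(x - r) * (x - w * r) * (x - w ^ 2 * r) = 0" using x w by Groebner_Basis.algebra
  then have "x = r \<or> x = w * r \<or> x = w ^ 2 * r" by auto
  then show "x \<in> F" using mem by (auto intro: subfield_closed[OF F])
  show "y \<in> F" using y mem by (auto simp: power2_eq_iff intro: subfield_closed[OF F])
qed

section \<open>The criterion for 5-torsion\<close>

lemma point_mult_5:
  "point_mult a 5 P = point_add a P (point_add a P (point_add a P (point_add a P P)))"
  by (cases P) (simp_all add: point_mult_def numeral_eq_Suc)

lemma point_add_chord:
  assumes "x1 \<noteq> x2" "(y2 - y1) / (x2 - x1) = m" "m ^ 2 - x1 - x2 = x3"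
  shows "point_add a (Affine x1 y1) (Affine x2 y2) = Affine x3 (m * (x1 - x3) - y1)"
  using assms by (auto simp: Let_def)

text \<open>\<open>5P\<close> vanishes iff \<open>4P = - P\<close>. Generically \<open>2P\<close>,
  \<open>3P\<close>, \<open>4P\<close> are computed by formulas, and the abscissas of
  \<open>4P\<close> and \<open>P\<close> differ by a nonzero multiple of
  \<open>psi5 \<delta>\<close>. The exceptional cases are points of order 2, 3 and 4.\<close>

lemma point_mult_5_eq_Infinity_iff:
  fixes x y c \<delta> :: "'a::field_char_0"
  assumes c: "c \<noteq> 0" and x: "x ^ 3 = \<delta> * c" and y: "y ^ 2 = (\<delta> + 1) * c"
  shows "point_mult 0 5 (Affine x y) = Infinity \<longleftrightarrow> psi5 \<delta> = 0"
proof (cases "\<delta> = - 1")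
  case True
  then have "y = 0" using y by simp
  then show ?thesis using True by (simp add: point_mult_5 psi5_def)
next
  case False
  \<comment> \<open>A sum \<open>(x', y')\<close> of \<open>P\<close> and another point has \<open>y' = m (x - x') - y\<close>, so that \<open>x' = x\<close> alone
    forces it to be \<open>- P\<close>.\<close>
  define P where "P = Affine x y"
  have d1: "\<delta> + 1 \<noteq> 0" using False by (simp add: eq_neg_iff_add_eq_0)
  have y0: "y \<noteq> 0" using y d1 c by auto
  then have y1: "y \<noteq> - y" by simp
  define x2 where "x2 = x * (\<delta> - 8) / (4 * (\<delta> + 1))"
  define n where "n = \<delta> ^ 2 + 20 * \<delta> - 8"
  define y2 where "y2 = y * n / (8 * (\<delta> + 1) ^ 2)"
  have m2: "(3 * x ^ 2) ^ 2 / (2 * y) ^ 2 = 9 * \<delta> * x / (4 * (\<delta> + 1))"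
  proof -
    have "(3 * x ^ 2) ^ 2 = 9 * \<delta> * x * c" using x by Groebner_Basis.algebra
    then show ?thesis using c d1 by (simp add: power_mult_distrib y)
  qed
  have x2: "(3 * x ^ 2 / (2 * y)) ^ 2 - x - x = x2"
    unfolding power_divide m2 x2_def using d1 by (simp add: divide_simps) Groebner_Basis.algebra
  have diff2: "x - x2 = 3 * x * (\<delta> + 4) / (4 * (\<delta> + 1))"
    unfolding x2_def using d1 by (simp add: divide_simps) Groebner_Basis.algebra
  have y2: "3 * x ^ 2 / (2 * y) * (x - x2) - y = y2"
  proof -
    have "3 * x ^ 2 / (2 * y) * (x - x2) = 9 * (\<delta> * c) * (\<delta> + 4) / (8 * y * (\<delta> + 1))"
      unfolding diff2 x [symmetric] using y0 d1 by (simp add: divide_simps) Groebner_Basis.algebra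
    also have "\<dots> = 9 * \<delta> * (\<delta> + 4) * y / (8 * (\<delta> + 1) ^ 2)"
      using y y0 d1 by (simp add: divide_simps) Groebner_Basis.algebra
    finally have eq: "3 * x ^ 2 / (2 * y) * (x - x2) = 9 * \<delta> * (\<delta> + 4) * y / (8 * (\<delta> + 1) ^ 2)" .
    show ?thesis
      unfolding eq y2_def n_def using d1 by (simp add: divide_simps) Groebner_Basis.algebra
  qed
  have P2: "point_add 0 P P = Affine x2 y2"
    by (simp only: P_def point_add.simps Let_def y1 simp_thms if_True if_False add_0_right x2 y2)
  show ?thesis
  proof (cases "x2 = x")
    case True
    then have "y2 = - y" using y2 by simp
    then have "point_mult 0 5 P \<noteq> Infinity"
      using True y1 by (simp add: point_mult_5 P2) (simp add: P_def Let_def)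
    moreover have "x = 0 \<or> \<delta> = - 4"
      using diff2 True d1 by (auto simp: eq_neg_iff_add_eq_0 simp del: distrib_left_numeral)
    then have "psi5 \<delta> \<noteq> 0" using x c by (auto simp: psi5_def)
    ultimately show ?thesis by (simp add: P_def)
  next
    case False
    then have x0: "x \<noteq> 0" and d4: "\<delta> + 4 \<noteq> 0" using diff2 by auto
    then have d0: "\<delta> \<noteq> 0" using x by auto
    \<comment> \<open>Slopes are written as \<open>y / x\<close> times a function of
      \<open>\<delta>\<close>. Since \<open>(y / x) ^ 2\<close> is \<open>x\<close> times such a
      function, so is every abscissa.\<close>
    define k3 where "k3 = (7 * \<delta> ^ 2 - 4 * \<delta> + 16) / (6 * (\<delta> + 1) * (\<delta> + 4))"
    have m3: "(y2 - y) / (x2 - x) = y / x * k3"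
    proof -
      have "y2 - y = - (y * (7 * \<delta> ^ 2 - 4 * \<delta> + 16) / (8 * (\<delta> + 1) ^ 2))"
        unfolding y2_def n_def using d1 by (simp add: divide_simps) Groebner_Basis.algebra
      moreover have "x2 - x = - (3 * x * (\<delta> + 4) / (4 * (\<delta> + 1)))"
        using diff2 by (simp add: algebra_simps)
      ultimately show ?thesis
        unfolding k3_def using d1 d4 x0
        by (simp only: minus_divide_divide) (simp add: divide_simps; Groebner_Basis.algebra)
    qed
    have yx: "(y / x) ^ 2 = (\<delta> + 1) * x / \<delta>"
      using x y x0 d0 by (simp add: divide_simps) Groebner_Basis.algebra
    define x3 where "x3 = x - 8 * (\<delta> + 1) * n * x / (9 * \<delta> * (\<delta> + 4) ^ 2)"
    have x3: "(y / x * k3) ^ 2 - x - x2 = x3"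
      unfolding power_mult_distrib yx k3_def x2_def x3_def n_def
      using d0 d1 d4 by (simp add: divide_simps) Groebner_Basis.algebra
    define y3 where "y3 = y / x * k3 * (x - x3) - y"
    have P3: "point_add 0 P (Affine x2 y2) = Affine x3 y3"
      by (simp only: P_def point_add_chord[OF False [symmetric] m3 x3] y3_def)
    show ?thesis
    proof (cases "x3 = x")
      case True
      then have "y3 = - y" by (simp add: y3_def)
      then have "point_mult 0 5 P \<noteq> Infinity"
        using True y1 by (simp add: point_mult_5 P2 P3) (simp add: P_def Let_def)
      moreover have "psi5 \<delta> \<noteq> 0"
      proof
        have "n = 0" using True d0 d1 d4 x0 by (simp add: x3_def del: distrib_left_numeral)
        assume "psi5 \<delta> = 0"
        \<comment> \<open>Euclidean algorithm: this is the remainder of \<open>psi5 \<delta>\<close>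
          by \<open>n\<close>, and \<open>100 * n\<close> equals 16 where
          \<open>10 * \<delta> = 4\<close>.\<close>
        with \<open>n = 0\<close> have "11664 * (10 * \<delta> - 4) = 0"
          unfolding psi5_def n_def by Groebner_Basis.algebra
        then have "10 * \<delta> = 4" by simp
        with \<open>n = 0\<close> have "(16 :: 'a) = 0"
          unfolding n_def by Groebner_Basis.algebra
        then show False by simp
      qed
      ultimately show ?thesis by (simp add: P_def)
    next
      case False
      then have n0: "n \<noteq> 0" by (auto simp: x3_def)
      define k4 where "k4 = - k3 + 9 * \<delta> * (\<delta> + 4) ^ 2 / (4 * (\<delta> + 1) * n)"
      have m4: "(y3 - y) / (x3 - x) = y / x * k4"
      proof -
        have eq: "(y3 - y) / (x3 - x) = - (y / x * k3) - 2 * y / (x3 - x)"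
          using False unfolding y3_def by (simp add: divide_simps) (simp add: algebra_simps)
        have diff3: "x3 - x = - (8 * (\<delta> + 1) * n * x / (9 * \<delta> * (\<delta> + 4) ^ 2))"
          by (simp add: x3_def)
        show ?thesis
          unfolding eq unfolding diff3 k4_def using d0 d1 d4 x0 n0
          by (simp add: divide_simps) Groebner_Basis.algebra
      qed
      define x4 where "x4 = (y / x * k4) ^ 2 - x - x3"
      define y4 where "y4 = y / x * k4 * (x - x4) - y"
      have P4: "point_add 0 P (Affine x3 y3) = Affine x4 y4"
        by (simp only: P_def point_add_chord[OF False [symmetric] m4 x4_def [symmetric]] y4_def)
      have "point_mult 0 5 P = Infinity \<longleftrightarrow> x4 = x"
        by (simp add: point_mult_5 P2 P3 P4) (auto simp add: P_def Let_def y4_def)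
      moreover have "x4 - x = - (3 * x * (\<delta> + 4) * psi5 \<delta> / (16 * (\<delta> + 1) * n ^ 2))"
        unfolding x4_def power_mult_distrib yx k4_def k3_def x3_def psi5_def
        using d0 d1 d4 n0 n_def by (simp add: divide_simps) Groebner_Basis.algebra
      ultimately show ?thesis using x0 d1 d4 n0 by (auto simp: P_def simp del: distrib_left_numeral)
    qed
  qed
qed

section \<open>Equality of the two fields\<close>

lemma primitive_root_of_unity_geometric:
  assumes "primitive_root_of_unity n z" "n > 1"
  shows "(\<Sum>i<n. z ^ i) = 0"
proof -
  have "z ^ 1 \<noteq> 1" "z ^ n = 1"
    using assms unfolding primitive_root_of_unity_def by blast+
  then show ?thesis by (simp add: sum_gp_strict)
qed

theorem theorem5p2:
  fixes K :: "'a::field_char_0 set" and c \<zeta>3 \<zeta>5 r s :: 'a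
  assumes "number_field K"
    and "algebraic_closure (ambient_ring :: 'a ring) K"
    and "c \<in> K" and "c \<noteq> 0"
    and "primitive_root_of_unity 3 \<zeta>3"
    and "primitive_root_of_unity 5 \<zeta>5"
    and "r ^ 3 = delta1 \<zeta>3 \<zeta>5 * c"
    and "s ^ 2 = (delta1 \<zeta>3 \<zeta>5 + 1) * c"
  shows "division_field K 0 c 5 = adjoin K {r, \<zeta>3, s}"
proof (rule antisym)
  note c = \<open>c \<in> K\<close> \<open>c \<noteq> 0\<close>
  define \<delta> where "\<delta> = delta1 \<zeta>3 \<zeta>5"
  have r: "r ^ 3 = \<delta> * c" and s: "s ^ 2 = (\<delta> + 1) * c"
    using assms(7,8) by (simp_all add: \<delta>_def)
  have \<zeta>3: "\<zeta>3 ^ 2 + \<zeta>3 + 1 = 0"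
    using primitive_root_of_unity_geometric[OF assms(5)] by (simp add: eval_nat_numeral algebra_simps)
  have "\<zeta>5 ^ 4 + \<zeta>5 ^ 3 + \<zeta>5 ^ 2 + \<zeta>5 + 1 = 0"
    using primitive_root_of_unity_geometric[OF assms(6)] by (simp add: eval_nat_numeral algebra_simps)
  with \<zeta>3 have \<delta>: "psi5 \<delta> = 0" unfolding \<delta>_def by (rule psi5_delta1)
  note \<delta>_nz = psi5_nonzero[OF \<delta>]

  let ?F = "adjoin K {r, \<zeta>3, s}" and ?C = "\<Union>P\<in>torsion_points 0 c 5. coordinates P"
  note F = adjoin_subfield[of K "{r, \<zeta>3, s}"]
  have mem: "r \<in> ?F" "s \<in> ?F" "\<zeta>3 \<in> ?F" "c \<in> ?F"
    using c by (auto intro: adjoin_incl)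
  \<comment> \<open>Although \<open>\<zeta>5\<close> is not adjoined, \<open>\<delta>\<close> is
    recovered as \<open>r ^ 3 / c\<close>.\<close>
  have \<delta>_mem: "\<delta> \<in> ?F"
    using subfield_divide[OF F subfield_power[OF F mem(1), of 3] mem(4)] r c by simp

  show "division_field K 0 c 5 \<subseteq> ?F"
    unfolding division_field_def
  proof (rule adjoin_minimal[OF F])
    show "K \<subseteq> ?F" by (auto intro: adjoin_incl)
    define f where "f a = a * (a - 8) ^ 3 / (64 * (a + 1) ^ 3)" for a :: 'a
    define g where "g = - ((\<delta> + 4) ^ 3) / (27 * \<delta> ^ 2)"
    define rational where
      "rational a \<longleftrightarrow> a \<in> ?F \<and> (\<exists>r\<in>?F. \<exists>s\<in>?F. r ^ 3 = a * c \<and> s ^ 2 = (a + 1) * c)" for a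
    have rat_f: "rational (f a)" if "rational a" "a \<noteq> - 1" for a
      using that double_rational[OF F _ _ _ _ _ that(2)] unfolding rational_def f_def
      by (auto intro!: subfield_closed[OF F])
    have rat_\<delta>: "rational \<delta>" using mem \<delta>_mem r s by (auto simp: rational_def)
    have rat_g: "rational g"
      using isogeny_rational[OF F mem(1,2) \<delta>_mem mem(3) r s \<delta>_nz(1) \<zeta>3] \<delta>_mem
      unfolding rational_def g_def by (auto intro!: subfield_closed[OF F])
    have g: "27 * \<delta> ^ 2 * g = - ((\<delta> + 4) ^ 3)" using \<delta>_nz by (simp add: g_def)
    have f: "64 * (a + 1) ^ 3 * f a = a * (a - 8) ^ 3" if "a \<noteq> - 1" for a
      using that by (simp add: f_def eq_neg_iff_add_eq_0)
    have g1: "g \<noteq> - 1" using psi5_nonzero(2)[OF psi5_isogeny[OF \<delta> g]] .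
    show "?C \<subseteq> ?F"
    proof
      fix u assume "u \<in> ?C"
      then obtain x y where u: "u \<in> {x, y}" and y: "y ^ 2 = x ^ 3 + c"
        and tors: "point_mult 0 5 (Affine x y) = Infinity"
        by (auto simp: torsion_points_def curve_points_def)
      define T where "T = x ^ 3 / c"
      have x3: "x ^ 3 = T * c" using c by (simp add: T_def)
      have y2: "y ^ 2 = (T + 1) * c" using y x3 by (simp add: algebra_simps)
      have "psi5 T = 0" using point_mult_5_eq_Infinity_iff[OF c(2) x3 y2] tors by simp
      then have "T \<in> {\<delta>, f \<delta>, g, f g}"
        using psi5_roots[OF \<delta> _ f g f] \<delta>_nz g1 by blast
      then have "rational T" using rat_\<delta> rat_g rat_f \<delta>_nz g1 by blast
      then obtain r' s' where "r' \<in> ?F" "s' \<in> ?F" "r' ^ 3 = T * c" "s' ^ 2 = (T + 1) * c"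
        unfolding rational_def by blast
      then have "x \<in> ?F \<and> y \<in> ?F"
        using rational_if_cube_eq[OF F _ _ mem(3) \<zeta>3] x3 y2 by metis
      then show "u \<in> ?F" using u by blast
    qed
  qed

  show "?F \<subseteq> division_field K 0 c 5"
    unfolding division_field_def
  proof (rule adjoin_minimal[OF adjoin_subfield])
    let ?D = "adjoin K ?C"
    show "K \<subseteq> ?D" by (auto intro: adjoin_incl)
    \<comment> \<open>Stated for every cube root, to cover both \<open>r\<close> and
      \<open>\<zeta>3 * r\<close>, whose quotient is \<open>\<zeta>3\<close>.\<close>
    have coord: "x \<in> ?D" "s \<in> ?D" if "x ^ 3 = \<delta> * c" for x
    proof -
      have "Affine x s \<in> torsion_points 0 c 5"
        using point_mult_5_eq_Infinity_iff[OF c(2) that s] \<delta> that s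
        by (auto simp: torsion_points_def curve_points_def algebra_simps)
      then show "x \<in> ?D" "s \<in> ?D" by (auto intro!: adjoin_incl bexI[of _ "Affine x s"])
    qed
    have "\<zeta>3 ^ 3 = 1" using \<zeta>3 by Groebner_Basis.algebra
    then have "(\<zeta>3 * r) ^ 3 = \<delta> * c" by (simp add: power_mult_distrib r)
    moreover have "r \<noteq> 0" using r \<delta>_nz c by auto
    ultimately have "\<zeta>3 \<in> ?D"
      using subfield_divide[OF adjoin_subfield coord(1)[of "\<zeta>3 * r"] coord(1)[OF r]] by simp
    then show "{r, \<zeta>3, s} \<subseteq> ?D" using coord[OF r] by simp
  qed
qed

end
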